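(* Let $f_k(t)=|t-1|^k$ for some $k>1$, let $P_0$ and $P_1$ be arbitrary distributions on a common space $\mathcal{X}$, and let $\varepsilon\ge0$. Let $Q$ be a Markov kernel from $\mathcal{X}$ to $\mathcal{Z}$ satisfying $$D_{f_k}\big(Q(\cdot\mid x)\,\|\,Q(\cdot\mid x')\big)\le\varepsilon^k\quad\text{for all }x,x'\in\mathcal{X},$$ and let $M_a(\cdot)=\int Q(\cdot\mid x)\,dP_a(x)$ for $a\in\{0,1\}$. Then $$D_{f_k}(M_0\|M_1)\le(2\varepsilon)^k\,\|P_0-P_1\|_{TV}^k.$$
   Context: For convex $f:\mathbb{R}_+\to\mathbb{R}\cup\{+\infty\}$ with $f(1)=0$, the $f$-divergence is $D_f(P\|Q)=\int f(dP/dQ)\,dQ$. $\|P_0-P_1\|_{TV}=\sup_A|P_0(A)-P_1(A)|$. *)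

theory Defs
  imports "HOL-Probability.Probability"
begin

definition ext_integral :: "'a measure \<Rightarrow> ('a \<Rightarrow> ereal) \<Rightarrow> ereal" where
  "ext_integral M g =
     enn2ereal (\<integral>\<^sup>+ x. e2ennreal (g x) \<partial>M) - enn2ereal (\<integral>\<^sup>+ x. e2ennreal (- g x) \<partial>M)"

text \<open>
  The $f$-divergence of probability measures on the same measurable space, for convex $f$ on
  $[0,\infty)$ with $f(1) = 0$; the values of \<open>f\<close> at negative arguments are never used. With
  \<open>p\<close> and \<open>q\<close> the densities of \<open>P\<close> and \<open>Q\<close> with respect to the dominating measure \<open>sup P Q\<close>,
  the quotient \<open>p / q\<close> is the density of the absolutely continuous part of \<open>P\<close> with
  respect to \<open>Q\<close>, and \<open>{q = 0}\<close> carries the singular part, which is weighted by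
  $f'(\infty) = \lim_{t \to \infty} f(t)/t$ with the convention $\infty \cdot 0 = 0$.
  The lemma \<open>f_divergence_absolutely_continuous\<close> below recovers $\int f(dP/dQ)\,dQ$. For
  $f(t) = |t-1|^k$ with $k > 1$ the weight is $\infty$, so the divergence
  is $\infty$ unless \<open>P\<close> is absolutely continuous with respect to \<open>Q\<close>.
\<close>

definition f_divergence :: "(real \<Rightarrow> ereal) \<Rightarrow> 'a measure \<Rightarrow> 'a measure \<Rightarrow> ereal" where
  "f_divergence f P Q =
     (let p = (\<lambda>z. enn2real (RN_deriv (sup P Q) P z));
          q = (\<lambda>z. enn2real (RN_deriv (sup P Q) Q z))
      in ext_integral Q (\<lambda>z. f (p z / q z))
         + Lim at_top (\<lambda>t. f t / ereal t) * ereal (measure P {z \<in> space P. q z = 0}))"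

definition f_pow :: "real \<Rightarrow> real \<Rightarrow> ereal" where
  "f_pow k t = ereal (\<bar>t - 1\<bar> powr k)"

definition tv_dist :: "'a measure \<Rightarrow> 'a measure \<Rightarrow> real" where
  "tv_dist P Q = (SUP A\<in>sets P. \<bar>measure P A - measure Q A\<bar>)"

lemma finite_measure_sup:
  assumes "finite_measure P" "finite_measure Q" "sets P = sets Q"
  shows "finite_measure (sup P Q)"
proof
  interpret P: finite_measure P by fact
  interpret Q: finite_measure Q by fact
  have sp: "space P = space Q" using assms(3) by (rule sets_eq_imp_space_eq)
  have eq: "sup P Q = sup_measure' P Q"
    using assms(3) sp unfolding sup_measure_def sup_lexord_def by auto
  have "emeasure (sup P Q) (space P) \<le> emeasure P (space P) + emeasure Q (space P)"
    unfolding eq emeasure_sup_measure'[OF assms(3)[symmetric] sets.top[of P]]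
    by (intro SUP_least add_mono emeasure_mono) (auto simp: assms(3)[symmetric] dest: sets.sets_into_space)
  moreover have "space (sup P Q) = space P"
    using assms(3) by (simp add: eq)
  ultimately show "emeasure (sup P Q) (space (sup P Q)) \<noteq> \<infinity>"
    using P.emeasure_finite Q.emeasure_finite
    by (metis ennreal_add_eq_top infinity_ennreal_def top.extremum_unique)
qed

lemma absolutely_continuous_sup:
  assumes "sets P = sets Q"
  shows "absolutely_continuous (sup P Q) P" "absolutely_continuous (sup P Q) Q"
    and "sets (sup P Q) = sets P"
proof -
  have eq: "sup P Q = sup_measure' P Q"
    using assms sets_eq_imp_space_eq[OF assms] unfolding sup_measure_def sup_lexord_def by auto
  show s: "sets (sup P Q) = sets P" using assms by (simp add: eq)
  have "emeasure P A \<le> emeasure (sup P Q) A" "emeasure Q A \<le> emeasure (sup P Q) A"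
    if "A \<in> sets P" for A
    using le_emeasure_sup_measure'1[OF assms[symmetric] that]
      le_emeasure_sup_measure'2[OF assms[symmetric] that] by (simp_all add: eq)
  then show "absolutely_continuous (sup P Q) P" "absolutely_continuous (sup P Q) Q"
    unfolding absolutely_continuous_def null_sets_def s assms[symmetric]
    by force+
qed

lemma f_divergence_absolutely_continuous:
  assumes "prob_space P" "prob_space Q" "sets P = sets Q" "absolutely_continuous Q P"
  shows "f_divergence f P Q = ext_integral Q (\<lambda>z. f (enn2real (RN_deriv Q P z)))"
proof -
  interpret P: prob_space P by fact
  interpret Q: prob_space Q by fact
  define M where "M = sup P Q"
  interpret M: finite_measure M
    unfolding M_def
    by (intro finite_measure_sup P.finite_measure_axioms Q.finite_measure_axioms assms)
  note ac = absolutely_continuous_sup[OF assms(3), folded M_def]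
  define p where "p = RN_deriv M P"
  define q where "q = RN_deriv M Q"
  have [measurable]: "p \<in> borel_measurable M" "q \<in> borel_measurable M"
    by (auto simp: p_def q_def)
  have sM: "sets M = sets Q" "sets M = sets P" "space M = space P" "space M = space Q"
    using ac(3) assms(3) by (auto dest: sets_eq_imp_space_eq)
  have P: "density M p = P" unfolding p_def using ac sM by (intro M.density_RN_deriv) auto
  have Q: "density M q = Q" unfolding q_def using ac sM by (intro M.density_RN_deriv) auto
  have fin: "AE z in M. p z \<noteq> \<infinity>" "AE z in M. q z \<noteq> \<infinity>"
    unfolding p_def q_def
    using M.RN_deriv_finite[OF _ ac(1)] M.RN_deriv_finite[OF _ ac(2)] sM
      P.sigma_finite_measure_axioms Q.sigma_finite_measure_axioms by auto
  have fq: "AE z in M. enn2real (q z) = 0 \<longrightarrow> q z = 0"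
    using fin(2) by eventually_elim (auto simp: enn2real_eq_0_iff)
  then have "AE z in Q. enn2real (q z) \<noteq> 0"
    unfolding Q[symmetric] by (subst AE_density) (auto elim: eventually_mono)
  then have Qp: "AE z in P. enn2real (q z) \<noteq> 0"
    using absolutely_continuous_AE[OF assms(3,4)] by simp
  have "AE z in P. \<not> (z \<in> space P \<and> enn2real (q z) = 0)"
    using Qp by eventually_elim auto
  then have sing: "measure P {z \<in> space P. enn2real (q z) = 0} = 0"
    by (intro measure_eq_AE[where B="{}" and M=P, simplified] )
      (auto simp: sM(2,3)[symmetric])
  have zero: "AE z in M. 0 < p z \<longrightarrow> enn2real (q z) \<noteq> 0"
    using Qp unfolding P[symmetric] by (subst (asm) AE_density) auto
  define h where "h z = ennreal (enn2real (p z) / enn2real (q z))" for z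
  have h[measurable]: "h \<in> borel_measurable M" unfolding h_def by measurable
  have "AE z in M. q z * h z = p z"
    using fin zero
  proof eventually_elim
    case (elim z)
    then obtain a b where ab: "p z = ennreal a" "q z = ennreal b" "0 \<le> a" "0 \<le> b"
      by (metis ennreal_cases infinity_ennreal_def)
    show ?case
    proof (cases "b = 0")
      case True
      then show ?thesis using elim ab by (auto simp: h_def)
    next
      case False
      then show ?thesis using ab by (simp add: h_def ennreal_mult[symmetric])
    qed
  qed
  then have "density Q h = P"
    unfolding Q[symmetric] P[symmetric]
    by (subst density_density_eq) (auto intro!: density_cong)
  moreover have "h \<in> borel_measurable Q"
    using h by (simp add: measurable_cong_sets[OF sM(1) refl])
  ultimately have hQ: "AE z in Q. h z = RN_deriv Q P z"
    by (intro Q.RN_deriv_unique)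
  have *: "AE z in Q. enn2real (p z) / enn2real (q z) = enn2real (RN_deriv Q P z)"
    using hQ
  proof eventually_elim
    case (elim z)
    have "enn2real (h z) = enn2real (p z) / enn2real (q z)"
      unfolding h_def by (rule enn2real_ennreal) simp
    then show ?case unfolding elim by (rule sym)
  qed
  have "ext_integral Q (\<lambda>z. f (enn2real (p z) / enn2real (q z)))
      = ext_integral Q (\<lambda>z. f (enn2real (RN_deriv Q P z)))"
    unfolding ext_integral_def
    by (intro arg_cong2[where f=minus] arg_cong[where f=enn2ereal] nn_integral_cong_AE
        eventually_mono[OF *]) simp_all
  then show ?thesis
    using sing by (simp add: f_divergence_def M_def p_def q_def zero_ereal_def[symmetric])
qed

end

theory Submission
  imports Defs "HOL-Real_Asymp.Real_Asymp"
begin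

text \<open>
  The theorem follows by duality. Let \<open>j\<close> be the exponent conjugate to \<open>k\<close>. The bound
  $D_{f_k}(P\|R) \le c^k$ holds if and only if
  $\int g\,dP - \int g\,dR \le c^k/k + \frac{1}{j}\int |g|^j\,dR$ for all bounded measurable \<open>g\<close>:
  optimised over the multiples of \<open>g\<close>, this is the statement that $dP/dR - 1$ has norm at most \<open>c\<close>
  as a functional on $L^j(R)$. A factor \<open>T\<close> in front of the right-hand side scales that norm to
  \<open>T * c\<close>. The two directions are
  \<open>f_pow_divergence_variational\<close> and \<open>f_pow_divergence_le_if_variational\<close>.

  Fix \<open>g\<close> and put $G(x) = \int g\,dQ(\cdot|x)$. The hypothesis bounds $|G(x) - G(x')|$ by
  $\varepsilon^k/k + \frac{1}{j}\int |g|^j\,dQ(\cdot|x')$. This is affine in $Q(\cdot|x')$, so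
  averaging over $x'$ drawn from $P_1$ gives $|G(x) - m| \le b$ for every \<open>x\<close>, with
  $m = \int g\,dM_1$ and $b = \varepsilon^k/k + \frac{1}{j}\int |g|^j\,dM_1$. Thus \<open>G\<close> takes its
  values in an interval of length $2b$, and
  $\int g\,dM_0 - \int g\,dM_1 = \int G\,dP_0 - \int G\,dP_1 \le 2b\,\|P_0-P_1\|_{TV}$ by
  \<open>integral_diff_le_tv_dist\<close>. The converse duality, with $c = \varepsilon$ and
  $T = 2\,\|P_0-P_1\|_{TV}$, turns this into the claim.

  The more direct argument with densities of $Q(\cdot|x)$ and Jensen's inequality would need these
  densities to be jointly measurable in $x$ and $z$, which can fail when the $\sigma$-algebra of
  $\mathcal{Z}$ is not countably generated. The dual form only integrates fixed functions \<open>g\<close>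
  against the kernel.
\<close>

section \<open>Power divergences through densities\<close>

lemma ext_integral_f_pow:
  "ext_integral Q (\<lambda>z. f_pow k (h z)) = enn2ereal (\<integral>\<^sup>+z. ennreal (\<bar>h z - 1\<bar> powr k) \<partial>Q)"
proof -
  have "e2ennreal (f_pow k (h z)) = ennreal (\<bar>h z - 1\<bar> powr k)" for z
    by (simp add: f_pow_def e2ennreal_ereal)
  moreover have "e2ennreal (- f_pow k (h z)) = 0" for z
    by (simp add: f_pow_def e2ennreal_neg ennreal_neg)
  ultimately show ?thesis
    by (simp add: ext_integral_def zero_ennreal.rep_eq)
qed

text \<open>
  Superlinear growth of $f_k$: the singular part of \<open>P\<close> enters the divergence with infinite weight.
\<close>

lemma Lim_f_pow_slope:
  assumes "k > 1"
  shows "Lim at_top (\<lambda>t. f_pow k t / ereal t) = \<infinity>"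
proof (rule tendsto_Lim)
  have "filterlim (\<lambda>t::real. \<bar>t - 1\<bar> powr k / t) at_top at_top"
    using assms by real_asymp
  then have "((\<lambda>t. ereal (\<bar>t - 1\<bar> powr k / t)) \<longlongrightarrow> \<infinity>) at_top"
    by (simp add: tendsto_PInfty_eq_at_top)
  moreover have "eventually (\<lambda>t. ereal (\<bar>t - 1\<bar> powr k / t) = f_pow k t / ereal t) at_top"
    using eventually_gt_at_top[of 0] by eventually_elim (simp add: f_pow_def)
  ultimately show "((\<lambda>t. f_pow k t / ereal t) \<longlongrightarrow> \<infinity>) at_top"
    by (rule Lim_transform_eventually)
qed simp

lemma absolutely_continuous_if_f_pow_divergence_finite:
  assumes "k > 1" and P: "prob_space P" and Q: "prob_space Q" and s: "sets P = sets Q"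
    and fin: "f_divergence (f_pow k) P Q < \<infinity>"
  shows "absolutely_continuous Q P"
proof -
  interpret P: prob_space P by fact
  interpret Q: prob_space Q by fact
  define M where "M = sup P Q"
  interpret M: finite_measure M
    unfolding M_def
    by (intro finite_measure_sup P.finite_measure_axioms Q.finite_measure_axioms s)
  note ac = absolutely_continuous_sup[OF s, folded M_def]
  define q where "q = RN_deriv M Q"
  have [measurable]: "q \<in> borel_measurable M"
    by (simp add: q_def)
  have sM: "sets M = sets Q" "sets M = sets P" "space M = space P"
    using ac(3) s by (auto dest: sets_eq_imp_space_eq)
  have Q_eq: "density M q = Q"
    unfolding q_def using ac sM by (intro M.density_RN_deriv) auto
  define S where "S = {z \<in> space P. enn2real (q z) = 0}"
  have S[measurable]: "S \<in> sets P"
    unfolding S_def sM(2,3)[symmetric] by measurable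
  have "measure P S = 0"
  proof (rule ccontr)
    assume "measure P S \<noteq> 0"
    then have "\<infinity> * ereal (measure P S) = \<infinity>"
      by (simp add: zero_less_measure_iff order.not_eq_order_implies_strict)
    with fin show False
      by (simp add: f_divergence_def Let_def ext_integral_f_pow Lim_f_pow_slope[OF \<open>k > 1\<close>]
          S_def q_def M_def)
  qed
  then have S0: "AE z in P. z \<notin> S"
    by (intro AE_not_in) (simp add: null_sets_def P.emeasure_eq_measure)
  show ?thesis
    unfolding absolutely_continuous_def
  proof
    fix A assume A: "A \<in> null_sets Q"
    then have [measurable]: "A \<in> sets M"
      by (auto simp: sM)
    have "AE z in Q. z \<notin> A"
      using A by (rule AE_not_in)
    then have "AE z in M. 0 < q z \<longrightarrow> z \<notin> A"
      unfolding Q_eq[symmetric] by (simp add: AE_density)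
    then have "AE z in P. 0 < q z \<longrightarrow> z \<notin> A"
      by (rule absolutely_continuous_AE[OF sM(2)[symmetric] ac(1)])
    then have "AE z in P. z \<notin> A"
      using S0 AE_space
      by eventually_elim (auto simp: S_def zero_less_iff_neq_zero)
    then show "A \<in> null_sets P"
      using \<open>A \<in> sets M\<close> sM(2) by (simp add: AE_iff_null_sets)
  qed
qed

lemma f_pow_divergence_density:
  assumes P: "prob_space P" and Q: "prob_space Q" and s: "sets P = sets Q"
    and ac: "absolutely_continuous Q P"
  obtains h :: "_ \<Rightarrow> real" where "h \<in> borel_measurable Q" "\<And>z. 0 \<le> h z" "P = density Q h"
    "\<And>k. f_divergence (f_pow k) P Q = enn2ereal (\<integral>\<^sup>+z. ennreal (\<bar>h z - 1\<bar> powr k) \<partial>Q)"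
proof
  interpret P: prob_space P by fact
  interpret Q: prob_space Q by fact
  let ?h = "\<lambda>z. enn2real (RN_deriv Q P z)"
  show "?h \<in> borel_measurable Q" "0 \<le> ?h z" for z
    by simp_all
  show "f_divergence (f_pow k) P Q = enn2ereal (\<integral>\<^sup>+z. ennreal (\<bar>?h z - 1\<bar> powr k) \<partial>Q)" for k
    by (simp add: f_divergence_absolutely_continuous[OF assms] ext_integral_f_pow)
  have "AE z in Q. RN_deriv Q P z \<noteq> \<infinity>"
    using s ac by (intro Q.RN_deriv_finite P.sigma_finite_measure_axioms) auto
  then have "density Q ?h = density Q (RN_deriv Q P)"
    by (intro density_cong) (auto elim!: eventually_mono simp: less_top)
  also have "\<dots> = P"
    using s ac by (intro Q.density_RN_deriv) auto
  finally show "P = density Q ?h"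
    by simp
qed

lemma integrable_bounded:
  fixes g :: "_ \<Rightarrow> real"
  assumes "prob_space M" "g \<in> borel_measurable M" "\<And>z. z \<in> space M \<Longrightarrow> \<bar>g z\<bar> \<le> B"
  shows "integrable M g"
proof -
  interpret prob_space M by fact
  show ?thesis
    using assms by (intro integrable_const_bound[where B=B]) auto
qed

section \<open>Variational form of the power divergence\<close>

text \<open>
  Writing \<open>P = density Q h\<close>, the left-hand side is $\int (h-1)\,g\,dQ$, to which Young's inequality
  applies pointwise. Young is used instead of Hoelder because the resulting bound is affine in \<open>Q\<close>
  and can therefore be averaged over a family of measures.
\<close>

lemma f_pow_divergence_variational:
  fixes g :: "'b \<Rightarrow> real"
  assumes kj: "k > 1" "j > 1" "1/k + 1/j = 1"
    and P: "prob_space P" and Q: "prob_space Q" and s: "sets P = sets Q"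
    and D: "f_divergence (f_pow k) P Q \<le> ereal c"
    and g: "g \<in> borel_measurable Q" and B: "\<And>z. z \<in> space Q \<Longrightarrow> \<bar>g z\<bar> \<le> B"
  shows "(\<integral>z. g z \<partial>P) - (\<integral>z. g z \<partial>Q) \<le> c / k + (\<integral>z. \<bar>g z\<bar> powr j \<partial>Q) / j"
proof -
  interpret P: prob_space P by fact
  interpret Q: prob_space Q by fact
  note [measurable] = g
  have "f_divergence (f_pow k) P Q < \<infinity>"
    using D by (auto intro: le_less_trans)
  then have "absolutely_continuous Q P"
    by (rule absolutely_continuous_if_f_pow_divergence_finite[OF kj(1) P Q s])
  then obtain h where [measurable]: "h \<in> borel_measurable Q" and h0: "\<And>z. 0 \<le> h z"
    and Ph: "P = density Q h"
    and Dh: "f_divergence (f_pow k) P Q = enn2ereal (\<integral>\<^sup>+z. ennreal (\<bar>h z - 1\<bar> powr k) \<partial>Q)"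
    using f_pow_divergence_density[OF P Q s] by metis
  have gP: "integrable P g"
    using B s by (intro integrable_bounded[OF P, where B=B])
      (auto simp: sets_eq_imp_space_eq[OF s] measurable_cong_sets[OF s refl])
  have gQ: "integrable Q g"
    using B by (intro integrable_bounded[OF Q, where B=B]) auto
  have gj: "integrable Q (\<lambda>z. \<bar>g z\<bar> powr j)"
    using B kj by (intro integrable_bounded[OF Q, where B="B powr j"]) (auto intro!: powr_mono2)
  have nn: "(\<integral>\<^sup>+z. ennreal (\<bar>h z - 1\<bar> powr k) \<partial>Q) \<le> ennreal c" and c: "0 \<le> c"
  proof -
    have le: "enn2ereal (\<integral>\<^sup>+z. ennreal (\<bar>h z - 1\<bar> powr k) \<partial>Q) \<le> ereal c"
      using D Dh by simp
    then show "0 \<le> c"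
      by (metis enn2ereal_nonneg order_trans ereal_less_eq(5))
    then show "(\<integral>\<^sup>+z. ennreal (\<bar>h z - 1\<bar> powr k) \<partial>Q) \<le> ennreal c"
      using le by (simp add: less_eq_ennreal.rep_eq enn2ereal_ennreal)
  qed
  have hk: "integrable Q (\<lambda>z. \<bar>h z - 1\<bar> powr k)"
    using nn by (intro integrableI_nonneg) (auto intro: le_less_trans)
  have hk_le: "(\<integral>z. \<bar>h z - 1\<bar> powr k \<partial>Q) \<le> c"
    using nn c by (rule integral_real_bounded[rotated])
  have hg: "integrable Q (\<lambda>z. h z * g z)" "(\<integral>z. g z \<partial>P) = (\<integral>z. h z * g z \<partial>Q)"
    using gP h0 unfolding Ph by (simp_all add: integrable_density integral_density)
  have "(\<integral>z. g z \<partial>P) - (\<integral>z. g z \<partial>Q) = (\<integral>z. (h z - 1) * g z \<partial>Q)"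
    using hg gQ by (simp add: left_diff_distrib)
  also have "\<dots> \<le> (\<integral>z. \<bar>h z - 1\<bar> powr k / k + \<bar>g z\<bar> powr j / j \<partial>Q)"
  proof (rule integral_mono)
    show "integrable Q (\<lambda>z. (h z - 1) * g z)"
      using hg gQ by (simp add: left_diff_distrib)
    show "integrable Q (\<lambda>z. \<bar>h z - 1\<bar> powr k / k + \<bar>g z\<bar> powr j / j)"
      using hk gj by simp
    fix z
    have "(h z - 1) * g z \<le> \<bar>h z - 1\<bar> * \<bar>g z\<bar>"
      by (metis abs_ge_self abs_mult)
    also have "\<dots> \<le> \<bar>h z - 1\<bar> powr k / k + \<bar>g z\<bar> powr j / j"
      using kj by (intro Youngs_inequality) auto
    finally show "(h z - 1) * g z \<le> \<bar>h z - 1\<bar> powr k / k + \<bar>g z\<bar> powr j / j" .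
  qed
  also have "\<dots> = (\<integral>z. \<bar>h z - 1\<bar> powr k \<partial>Q) / k + (\<integral>z. \<bar>g z\<bar> powr j \<partial>Q) / j"
    using hk gj by simp
  also have "\<dots> \<le> c / k + (\<integral>z. \<bar>g z\<bar> powr j \<partial>Q) / j"
    using hk_le kj by (intro add_right_mono divide_right_mono) auto
  finally show ?thesis .
qed

text \<open>
  The optimisation over the scale \<open>s\<close> of a test function. It recovers the Hoelder form
  $I \le T \varepsilon\, I^{1/j}$ from the Young form, and this is
  $I^{1/k} \le T \varepsilon$ since $1 - 1/j = 1/k$.
\<close>

lemma power_bound_by_scaling:
  fixes I T \<epsilon> :: real
  assumes kj: "k > 1" "j > 1" "1/k + 1/j = 1"
    and "I \<ge> 0" "T \<ge> 0" "\<epsilon> \<ge> 0"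
    and le: "\<And>s. s > 0 \<Longrightarrow> s * I \<le> T * (\<epsilon> powr k / k + s powr j * I / j)"
  shows "I \<le> (T * \<epsilon>) powr k"
proof (cases "I = 0")
  case False
  then have I: "I > 0"
    using \<open>I \<ge> 0\<close> by simp
  have jk: "k / j = k - 1" "1 - 1/j = 1/k"
    using kj by (auto simp: field_simps)
  \<comment> \<open>The optimal \<open>s\<close> satisfies $s^j I = \varepsilon^k$, so it vanishes for \<open>\<epsilon> = 0\<close>. Working
    with \<open>e > \<epsilon>\<close> keeps it positive.\<close>
  have "I powr (1/k) \<le> T * e" if e: "e > \<epsilon>" for e
  proof -
    have e0: "e > 0"
      using e \<open>\<epsilon> \<ge> 0\<close> by simp
    define s where "s = e powr (k / j) * I powr (- 1 / j)"
    have s: "s > 0"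
      using e0 I by (simp add: s_def)
    have "s powr j = e powr k * I powr (-1)"
      using kj by (simp add: s_def powr_mult powr_powr)
    then have 1: "s powr j * I = e powr k"
      using I by (simp add: powr_minus)
    have "s * I = e powr (k - 1) * (I powr (- 1/j) * I powr 1)"
      using I by (simp add: s_def jk)
    also have "\<dots> = e powr (k - 1) * I powr (1 / k)"
      unfolding powr_add[symmetric] jk(2)[symmetric] by simp
    finally have 2: "s * I = e powr (k - 1) * I powr (1 / k)" .
    have "s * I \<le> T * (\<epsilon> powr k / k + e powr k / j)"
      using le[OF s] by (simp add: 1)
    also have "\<dots> \<le> T * (e powr k / k + e powr k / j)"
      using kj e assms by (intro mult_left_mono add_right_mono divide_right_mono powr_mono2) auto
    also have "e powr k / k + e powr k / j = e powr k * (1/k + 1/j)"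
      by (simp add: algebra_simps)
    also have "T * \<dots> = e powr (k - 1) * (T * e)"
      using e0 powr_add[of e "k - 1" 1] by (simp add: kj)
    finally show ?thesis
      unfolding 2 using e0 by simp
  qed
  then have "I powr (1/k) \<le> T * \<epsilon>"
    by (intro tendsto_lowerbound[where F="at_right \<epsilon>" and f="\<lambda>e. T * e"] tendsto_intros)
      (auto simp: eventually_at_right_less eventually_at_filter)
  then have "(I powr (1/k)) powr k \<le> (T * \<epsilon>) powr k"
    using kj by (intro powr_mono2) auto
  then show ?thesis
    using I kj by (simp add: powr_powr)
qed simp

text \<open>
  Multiples of the indicator of a \<open>Q\<close>-null set show that \<open>P\<close> has a density \<open>h\<close>. Equality in Young's
  inequality suggests testing with $\mathrm{sgn}(h-1)\,|h-1|^{k-1}$, whose \<open>j\<close>-th power is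
  $|h-1|^k$. Truncating $|h-1|$ at level \<open>n\<close> keeps the test function bounded and its integrals
  finite, so that the bound can be solved for the truncated divergence; monotone convergence
  then removes the truncation.
\<close>

lemma f_pow_divergence_le_if_variational:
  assumes kj: "k > 1" "j > 1" "1/k + 1/j = 1"
    and P: "prob_space P" and Q: "prob_space Q" and s: "sets P = sets Q"
    and T: "T \<ge> 0" and \<epsilon>: "\<epsilon> \<ge> 0"
    and var: "\<And>(g :: 'b \<Rightarrow> real) B. g \<in> borel_measurable Q \<Longrightarrow> (\<And>z. z \<in> space Q \<Longrightarrow> \<bar>g z\<bar> \<le> B) \<Longrightarrow>
      (\<integral>z. g z \<partial>P) - (\<integral>z. g z \<partial>Q) \<le> T * (\<epsilon> powr k / k + (\<integral>z. \<bar>g z\<bar> powr j \<partial>Q) / j)"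
  shows "f_divergence (f_pow k) P Q \<le> ereal ((T * \<epsilon>) powr k)"
proof -
  interpret P: prob_space P by fact
  interpret Q: prob_space Q by fact
  have jk: "(k - 1) * j = k"
    using kj by (auto simp: field_simps)
  have "absolutely_continuous Q P"
    unfolding absolutely_continuous_def
  proof
    fix A assume A: "A \<in> null_sets Q"
    then have [measurable]: "A \<in> sets Q" "A \<in> sets P"
      by (auto simp: s)
    have QA: "measure Q A = 0"
      using A by (simp add: measure_def null_sets_def)
    have le: "x * measure P A \<le> T * (\<epsilon> powr k / k)" if "x > 0" for x
    proof -
      have "\<bar>x * indicator A z\<bar> powr j = x powr j * indicator A z" for z
        using that kj by (simp add: indicator_def)
      then have "(\<integral>z. \<bar>x * indicator A z\<bar> powr j \<partial>Q) = 0"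
        using QA by simp
      then show ?thesis
        using var[of "\<lambda>z. x * indicator A z" x] that QA by (simp add: abs_mult)
    qed
    have "measure P A = 0"
    proof (rule ccontr)
      assume "measure P A \<noteq> 0"
      then have pos: "measure P A > 0"
        by (simp add: order.not_eq_order_implies_strict)
      have "T * (\<epsilon> powr k / k) \<ge> 0"
        using T kj by simp
      \<comment> \<open>At this scale the left-hand side of \<open>le\<close> exceeds the right-hand side by \<open>1\<close>.\<close>
      then have "(T * (\<epsilon> powr k / k) + 1) / measure P A > 0"
        using pos by (intro divide_pos_pos) auto
      from le[OF this] pos show False
        by simp
    qed
    then show "A \<in> null_sets P"
      by (simp add: null_sets_def P.emeasure_eq_measure)
  qed
  then obtain h where [measurable]: "h \<in> borel_measurable Q" and h0: "\<And>z. 0 \<le> h z"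
    and Ph: "P = density Q h"
    and Dh: "f_divergence (f_pow k) P Q = enn2ereal (\<integral>\<^sup>+z. ennreal (\<bar>h z - 1\<bar> powr k) \<partial>Q)"
    using f_pow_divergence_density[OF P Q s] by metis
  define t where "t n z = min \<bar>h z - 1\<bar> (real n)" for n z
  have [measurable]: "t n \<in> borel_measurable Q" for n
    unfolding t_def by measurable
  have t: "0 \<le> t n z" "t n z \<le> real n" "t n z \<le> \<bar>h z - 1\<bar>" for n z
    by (auto simp: t_def)
  have ti: "integrable Q (\<lambda>z. t n z powr k)" for n
    using t kj by (intro integrable_bounded[OF Q, where B="real n powr k"]) (auto intro!: powr_mono2)
  have bound: "(\<integral>z. t n z powr k \<partial>Q) \<le> (T * \<epsilon>) powr k" for n
  proof (rule power_bound_by_scaling[OF kj _ T \<epsilon>])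
    show "0 \<le> (\<integral>z. t n z powr k \<partial>Q)"
      by simp
    fix x :: real assume x: "x > 0"
    define g where "g z = x * (sgn (h z - 1) * t n z powr (k - 1))" for z
    have [measurable]: "g \<in> borel_measurable Q"
      unfolding g_def by measurable
    have gb: "\<bar>g z\<bar> \<le> x * real n powr (k - 1)" for z
      using x t kj unfolding g_def abs_mult
      by (intro mult_mono order_trans[OF mult_left_le_one_le]) (auto simp: sgn_if intro!: powr_mono2)
    have gj: "\<bar>g z\<bar> powr j = x powr j * t n z powr k" for z
    proof (cases "h z = 1")
      case True
      then show ?thesis
        by (simp add: g_def t_def)
    next
      case False
      then have "\<bar>g z\<bar> = x * t n z powr (k - 1)"
        using x by (simp add: g_def abs_mult sgn_if)
      then show ?thesis
        using x by (simp add: powr_mult powr_powr jk)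
    qed
    have gP: "integrable P g"
      using gb s by (intro integrable_bounded[OF P]) (auto simp: measurable_cong_sets[OF s refl])
    have gQ: "integrable Q g"
      using gb by (intro integrable_bounded[OF Q]) auto
    have hg: "integrable Q (\<lambda>z. h z * g z)" "(\<integral>z. g z \<partial>P) = (\<integral>z. h z * g z \<partial>Q)"
      using gP h0 unfolding Ph by (simp_all add: integrable_density integral_density)
    have "x * (\<integral>z. t n z powr k \<partial>Q) = (\<integral>z. x * t n z powr k \<partial>Q)"
      by simp
    also have "\<dots> \<le> (\<integral>z. h z * g z - g z \<partial>Q)"
    proof (rule integral_mono)
      show "integrable Q (\<lambda>z. x * t n z powr k)" "integrable Q (\<lambda>z. h z * g z - g z)"
        using ti hg gQ by auto
      fix z
      have "t n z powr k = t n z powr (k - 1) * t n z"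
        using t(1)[of n z] powr_add[of "t n z" "k - 1" 1] by simp
      also have "\<dots> \<le> t n z powr (k - 1) * \<bar>h z - 1\<bar>"
        using t by (intro mult_left_mono) auto
      finally have "x * t n z powr k \<le> x * (t n z powr (k - 1) * \<bar>h z - 1\<bar>)"
        using x by (intro mult_left_mono) auto
      also have "\<dots> = h z * g z - g z"
        by (simp add: g_def abs_sgn algebra_simps)
      finally show "x * t n z powr k \<le> h z * g z - g z" .
    qed
    also have "\<dots> = (\<integral>z. g z \<partial>P) - (\<integral>z. g z \<partial>Q)"
      using hg gQ by simp
    also have "\<dots> \<le> T * (\<epsilon> powr k / k + (\<integral>z. \<bar>g z\<bar> powr j \<partial>Q) / j)"
      using gb by (intro var) auto
    finally show "x * (\<integral>z. t n z powr k \<partial>Q)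
        \<le> T * (\<epsilon> powr k / k + x powr j * (\<integral>z. t n z powr k \<partial>Q) / j)"
      by (simp add: gj)
  qed
  have "(\<integral>\<^sup>+z. ennreal (\<bar>h z - 1\<bar> powr k) \<partial>Q) = (\<integral>\<^sup>+z. (SUP n. ennreal (t n z powr k)) \<partial>Q)"
  proof (intro nn_integral_cong antisym)
    fix z
    obtain n where "\<bar>h z - 1\<bar> \<le> real n"
      using real_arch_simple by blast
    then have "t n z = \<bar>h z - 1\<bar>"
      by (simp add: t_def)
    then show "ennreal (\<bar>h z - 1\<bar> powr k) \<le> (SUP n. ennreal (t n z powr k))"
      by (metis SUP_upper UNIV_I)
    show "(SUP n. ennreal (t n z powr k)) \<le> ennreal (\<bar>h z - 1\<bar> powr k)"
      using t kj by (intro SUP_least ennreal_leI powr_mono2) auto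
  qed
  also have "\<dots> = (SUP n. \<integral>\<^sup>+z. ennreal (t n z powr k) \<partial>Q)"
    using kj by (intro nn_integral_monotone_convergence_SUP)
      (auto simp: mono_def le_fun_def t_def intro!: ennreal_leI powr_mono2)
  also have "\<dots> \<le> ennreal ((T * \<epsilon>) powr k)"
    using bound ti by (intro SUP_least) (simp add: nn_integral_eq_integral ennreal_leI)
  finally show ?thesis
    unfolding Dh by (metis enn2ereal_ennreal less_eq_ennreal.rep_eq powr_ge_zero)
qed

section \<open>Total variation and integrals\<close>

lemma abs_measure_diff_le_tv_dist:
  assumes P: "prob_space P" and R: "prob_space R" and A: "A \<in> sets P"
  shows "\<bar>measure P A - measure R A\<bar> \<le> tv_dist P R"
proof -
  interpret P: prob_space P by fact
  interpret R: prob_space R by fact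
  have "\<bar>measure P B - measure R B\<bar> \<le> 1" for B
    using P.prob_le_1[of B] R.prob_le_1[of B] measure_nonneg[of P B] measure_nonneg[of R B]
    by linarith
  then show ?thesis
    unfolding tv_dist_def using A by (intro cSUP_upper bdd_aboveI2[where M=1]) auto
qed

text \<open>
  The integral of \<open>G\<close> against \<open>P - R\<close> is the integral of \<open>G - a\<close>, since the total mass of
  \<open>P - R\<close> is zero. On a Hahn set \<open>Y\<close>, where \<open>P\<close> dominates, \<open>G - a\<close> may be enlarged to \<open>b - a\<close>,
  and off \<open>Y\<close> it may be lowered to \<open>0\<close>; what is left is \<open>(b - a) * (P Y - R Y)\<close>.
\<close>

lemma integral_diff_le_tv_dist:
  fixes G :: "'a \<Rightarrow> real"
  assumes P: "prob_space P" and R: "prob_space R" and s: "sets P = sets R"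
    and G[measurable]: "G \<in> borel_measurable R"
    and Gb: "\<And>x. x \<in> space R \<Longrightarrow> a \<le> G x" "\<And>x. x \<in> space R \<Longrightarrow> G x \<le> b"
  shows "(\<integral>x. G x \<partial>P) - (\<integral>x. G x \<partial>R) \<le> (b - a) * tv_dist P R"
proof -
  interpret P: prob_space P by fact
  interpret R: prob_space R by fact
  note [measurable_cong] = s
  have sp: "space P = space R"
    using s by (rule sets_eq_imp_space_eq)
  obtain Y where Y[measurable]: "Y \<in> sets R"
    and in_Y: "\<And>A. A \<in> sets R \<Longrightarrow> A \<subseteq> Y \<Longrightarrow> emeasure R A \<le> emeasure P A"
    and out_Y: "\<And>A. A \<in> sets R \<Longrightarrow> A \<inter> Y = {} \<Longrightarrow> emeasure P A \<le> emeasure R A"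
    using finite_unsigned_Hahn_decomposition[OF P.finite_measure_axioms R.finite_measure_axioms]
      s by metis
  have ab: "a \<le> b"
    using Gb R.not_empty by (meson all_not_in_conv order_trans)
  \<comment> \<open>Domination on the measurable subsets of \<open>C\<close> passes to integrals over \<open>C\<close>. It is used twice,
    with the roles of \<open>P\<close> and \<open>R\<close> exchanged between \<open>Y\<close> and its complement.\<close>
  have mono: "(\<integral>x. u x * indicator C x \<partial>M) \<le> (\<integral>x. u x * indicator C x \<partial>N)"
    if MN: "prob_space M" "prob_space N" "sets M = sets R" "sets N = sets R" and C: "C \<in> sets R"
      and le: "\<And>A. A \<in> sets R \<Longrightarrow> A \<subseteq> C \<Longrightarrow> emeasure M A \<le> emeasure N A"
      and u: "u \<in> borel_measurable R" "\<And>x. x \<in> space R \<Longrightarrow> 0 \<le> u x" "\<And>x. x \<in> space R \<Longrightarrow> u x \<le> b - a"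
    for M N C and u :: "'a \<Rightarrow> real"
  proof -
    interpret M: prob_space M by fact
    interpret N: prob_space N by fact
    note [measurable_cong] = MN(3,4)
    note [measurable] = C u(1)
    have sp: "space M = space R" "space N = space R"
      using MN by (auto dest: sets_eq_imp_space_eq)
    have int: "integrable N (\<lambda>x. u x * indicator C x)"
      using u ab by (intro integrable_bounded[OF MN(2), where B="b - a"]) (auto simp: sp indicator_def)
    have "density M (indicator C) \<le> density N (indicator C)"
      using le C by (subst le_measure)
        (auto simp: MN emeasure_density indicator_inter_arith[symmetric] sets.Int)
    then have "(\<integral>\<^sup>+x. ennreal (u x) \<partial>density M (indicator C)) \<le> (\<integral>\<^sup>+x. ennreal (u x) \<partial>density N (indicator C))"
      by (intro nn_integral_mono_measure) (auto simp: MN)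
    then have "(\<integral>\<^sup>+x. ennreal (u x * indicator C x) \<partial>M) \<le> (\<integral>\<^sup>+x. ennreal (u x * indicator C x) \<partial>N)"
      by (simp add: nn_integral_density mult.commute ennreal_mult'' ennreal_indicator)
    also have "\<dots> = ennreal (\<integral>x. u x * indicator C x \<partial>N)"
      using int u by (intro nn_integral_eq_integral) (auto simp: sp indicator_def)
    finally show ?thesis
      using u by (intro integral_real_bounded) (auto simp: sp intro!: integral_nonneg_AE)
  qed
  have int: "integrable M (\<lambda>x. f (G x) * indicator C x)"
    if "M = P \<or> M = R" "f = (\<lambda>y. y - a) \<or> f = (\<lambda>y. b - y)" "C \<in> sets R" for M C and f :: "real \<Rightarrow> real"
    using that Gb ab P R
    by (intro integrable_bounded[where B="b - a"]) (auto simp: sp indicator_def)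
  have Yc: "(\<integral>x. (G x - a) * indicator (space R - Y) x \<partial>P) \<le> (\<integral>x. (G x - a) * indicator (space R - Y) x \<partial>R)"
    using Gb out_Y by (intro mono P R s refl) (auto intro: out_Y)
  have Yb: "(\<integral>x. (b - G x) * indicator Y x \<partial>R) \<le> (\<integral>x. (b - G x) * indicator Y x \<partial>P)"
    using Gb by (intro mono P R s refl) (auto intro: in_Y)
  have split: "(\<integral>x. G x \<partial>M) = a + (b - a) * measure M Y - (\<integral>x. (b - G x) * indicator Y x \<partial>M)
      + (\<integral>x. (G x - a) * indicator (space R - Y) x \<partial>M)" if M: "M = P \<or> M = R" for M
  proof -
    interpret M: prob_space M using M P R by auto
    have [measurable_cong]: "sets M = sets R"
      using M s by auto
    have iY: "integrable M (\<lambda>x. (b - a) * indicator Y x)"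
      using ab by (intro integrable_bounded[OF M.prob_space_axioms, where B="b - a"])
        (auto simp: indicator_def)
    have mY: "measure M (Y \<inter> space M) = measure M Y"
      using M s Y sets.sets_into_space[OF Y] sp by (auto simp: Int_absorb2)
    have "(\<integral>x. G x \<partial>M) = (\<integral>x. a + (b - a) * indicator Y x - (b - G x) * indicator Y x
        + (G x - a) * indicator (space R - Y) x \<partial>M)"
      using M sp by (intro Bochner_Integration.integral_cong) (auto simp: indicator_def)
    also have "\<dots> = a + (b - a) * measure M Y - (\<integral>x. (b - G x) * indicator Y x \<partial>M)
      + (\<integral>x. (G x - a) * indicator (space R - Y) x \<partial>M)"
      using int[OF M, of "\<lambda>y. b - y" Y] int[OF M, of "\<lambda>y. y - a" "space R - Y"] iY
      by (simp add: M.prob_space mY del: integrable_mult_right_iff)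
    finally show ?thesis .
  qed
  have "measure P Y - measure R Y \<le> tv_dist P R"
    using abs_measure_diff_le_tv_dist[OF P R, of Y] by (simp add: s abs_le_iff)
  then have "(b - a) * (measure P Y - measure R Y) \<le> (b - a) * tv_dist P R"
    using ab by (intro mult_left_mono) auto
  then show ?thesis
    using Yc Yb split[of P] split[of R] by (simp add: right_diff_distrib)
qed

section \<open>Contraction of the power divergence under a kernel\<close>

theorem proposition8:
  fixes X :: "'a measure" and Z :: "'b measure"
    and P0 P1 :: "'a measure" and Q :: "'a \<Rightarrow> 'b measure" and k \<epsilon> :: real
  assumes "k > 1" and "\<epsilon> \<ge> 0"
    and "prob_space P0" and "sets P0 = sets X"
    and "prob_space P1" and "sets P1 = sets X"
    and "Q \<in> X \<rightarrow>\<^sub>M prob_algebra Z"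
    and "\<And>x x'. x \<in> space X \<Longrightarrow> x' \<in> space X \<Longrightarrow>
           f_divergence (f_pow k) (Q x) (Q x') \<le> ereal (\<epsilon> powr k)"
  shows "f_divergence (f_pow k) (P0 \<bind> Q) (P1 \<bind> Q)
           \<le> ereal ((2 * \<epsilon>) powr k * tv_dist P0 P1 powr k)"
proof -
  interpret P0: prob_space P0 by fact
  interpret P1: prob_space P1 by fact
  note sP[measurable_cong] = \<open>sets P0 = sets X\<close> \<open>sets P1 = sets X\<close>
  note spP = sets_eq_imp_space_eq[OF sP(1)] sets_eq_imp_space_eq[OF sP(2)]
  have Q[measurable]: "Q \<in> X \<rightarrow>\<^sub>M subprob_algebra Z"
    using assms(7) by (rule measurable_prob_algebraD)
  have Qx: "prob_space (Q x)" "sets (Q x) = sets Z" "space (Q x) = space Z" if "x \<in> space X" for x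
    using measurable_space[OF assms(7) that] by (auto simp: space_prob_algebra dest: sets_eq_imp_space_eq)
  have Qx1: "emeasure (Q x) (space Z) = 1" if "x \<in> space X" for x
    using prob_space.emeasure_space_1[OF Qx(1)[OF that]] Qx(3)[OF that] by simp
  define j where "j = k / (k - 1)"
  have kj: "k > 1" "j > 1" "1/k + 1/j = 1"
    using \<open>k > 1\<close> by (auto simp: j_def field_simps)
  have bind: "prob_space (P \<bind> Q)" "sets (P \<bind> Q) = sets Z" "space (P \<bind> Q) = space Z"
    "\<And>g B. g \<in> borel_measurable Z \<Longrightarrow> (\<And>z. z \<in> space Z \<Longrightarrow> \<bar>g z\<bar> \<le> B) \<Longrightarrow>
      (\<integral>z. g z \<partial>(P \<bind> Q)) = (\<integral>x. (\<integral>z. (g z :: real) \<partial>Q x) \<partial>P)"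
    if P: "prob_space P" "sets P = sets X" for P
  proof -
    interpret P: prob_space P by fact
    have PX: "P \<in> space (prob_algebra X)"
      using P by (simp add: space_prob_algebra)
    show "prob_space (P \<bind> Q)" "sets (P \<bind> Q) = sets Z"
      using prob_space_bind'[OF PX assms(7)] sets_bind'[OF PX assms(7)] by auto
    then show "space (P \<bind> Q) = space Z"
      by (rule_tac sets_eq_imp_space_eq)
    fix g B assume "g \<in> borel_measurable Z" "\<And>z. z \<in> space Z \<Longrightarrow> \<bar>g z :: real\<bar> \<le> B"
    then show "(\<integral>z. g z \<partial>(P \<bind> Q)) = (\<integral>x. (\<integral>z. (g z :: real) \<partial>Q x) \<partial>P)"
      using Qx sets_eq_imp_space_eq[OF P(2)]
      by (intro integral_bind[where K=Z and B=B and B'=1] P.finite_measure_axioms)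
        (auto simp: measurable_cong_sets[OF P(2) refl] Qx1 intro!: AE_I2)
  qed
  note bind0 = bind[OF P0.prob_space_axioms sP(1)] and bind1 = bind[OF P1.prob_space_axioms sP(2)]
  define \<tau> where "\<tau> = tv_dist P0 P1"
  have \<tau>: "\<tau> \<ge> 0"
    using abs_measure_diff_le_tv_dist[OF assms(3,5), of "{}"] by (simp add: \<tau>_def)
  have "f_divergence (f_pow k) (P0 \<bind> Q) (P1 \<bind> Q) \<le> ereal ((2 * \<tau> * \<epsilon>) powr k)"
  proof (rule f_pow_divergence_le_if_variational[OF kj bind0(1) bind1(1) _ _ \<open>\<epsilon> \<ge> 0\<close>])
    show "sets (P0 \<bind> Q) = sets (P1 \<bind> Q)"
      using bind0 bind1 by simp
    show "0 \<le> 2 * \<tau>"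
      using \<tau> by simp
    fix g :: "'b \<Rightarrow> real" and B
    assume gM: "g \<in> borel_measurable (P1 \<bind> Q)" and gB: "\<And>z. z \<in> space (P1 \<bind> Q) \<Longrightarrow> \<bar>g z\<bar> \<le> B"
    have g[measurable]: "g \<in> borel_measurable Z"
      using gM by (simp add: measurable_cong_sets[OF bind1(2) refl])
    have B: "\<bar>g z\<bar> \<le> B" if "z \<in> space Z" for z
      using gB that by (simp add: bind1)
    define G where "G x = (\<integral>z. g z \<partial>Q x)" for x
    define N where "N x = (\<integral>z. \<bar>g z\<bar> powr j \<partial>Q x)" for x
    have [measurable]: "G \<in> borel_measurable X" "N \<in> borel_measurable X"
      unfolding G_def N_def by measurable
    have Bj: "\<bar>\<bar>g z\<bar> powr j\<bar> \<le> B powr j" if "z \<in> space Z" for z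
      using B[OF that] kj by (auto intro!: powr_mono2)
    have abs_le: "\<bar>\<integral>z. u z \<partial>Q x\<bar> \<le> b" if "x \<in> space X" "u \<in> borel_measurable Z"
      "\<And>z. z \<in> space Z \<Longrightarrow> \<bar>u z\<bar> \<le> b" for x b and u :: "'b \<Rightarrow> real"
    proof -
      interpret Qx: prob_space "Q x" by (rule Qx) fact
      have "integrable (Q x) u"
        using that Qx[OF that(1)] by (intro integrable_bounded[OF Qx.prob_space_axioms, where B=b])
          (auto simp: measurable_cong_sets[OF Qx(2)[OF that(1)] refl])
      then have "\<bar>\<integral>z. u z \<partial>Q x\<bar> \<le> (\<integral>z. b \<partial>Q x)"
        using that Qx by (intro order_trans[OF integral_abs_bound] integral_mono) auto
      then show ?thesis
        by (simp add: Qx.prob_space)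
    qed
    have G1: "integrable P1 G"
      using abs_le[OF _ g B] by (intro integrable_bounded[OF P1.prob_space_axioms, where B=B]) (auto simp: G_def spP)
    have N1: "integrable P1 N"
      using abs_le[OF _ _ Bj] by (intro integrable_bounded[OF P1.prob_space_axioms, where B="B powr j"]) (auto simp: N_def spP)
    define m where "m = (\<integral>x. G x \<partial>P1)"
    define b where "b = \<epsilon> powr k / k + (\<integral>x. N x \<partial>P1) / j"
    have dev: "\<bar>G x - m\<bar> \<le> b" if x: "x \<in> space X" for x
    proof -
      have pt: "\<bar>G x - G x'\<bar> \<le> \<epsilon> powr k / k + N x' / j" if x': "x' \<in> space X" for x'
      proof -
        have v: "(\<integral>z. u z \<partial>Q x) - (\<integral>z. u z \<partial>Q x') \<le> \<epsilon> powr k / k + (\<integral>z. \<bar>u z\<bar> powr j \<partial>Q x') / j"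
          if "u \<in> borel_measurable Z" "\<And>z. z \<in> space Z \<Longrightarrow> \<bar>u z\<bar> \<le> B" for u :: "'b \<Rightarrow> real"
          using that Qx[OF x] Qx[OF x'] assms(8)[OF x x']
          by (intro f_pow_divergence_variational[OF kj, where B=B])
            (auto simp: measurable_cong_sets[OF Qx(2)[OF x'] refl])
        \<comment> \<open>The right-hand side of \<open>v\<close> is even in \<open>u\<close>, so \<open>- g\<close> gives the other sign.\<close>
        show ?thesis
          using v[OF g B] v[of "\<lambda>z. - g z"] B by (simp add: G_def N_def)
      qed
      have "\<bar>G x - m\<bar> = \<bar>\<integral>x'. G x - G x' \<partial>P1\<bar>"
        using G1 by (simp add: m_def P1.prob_space)
      also have "\<dots> \<le> (\<integral>x'. \<epsilon> powr k / k + N x' / j \<partial>P1)"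
        using G1 N1 pt by (intro order_trans[OF integral_abs_bound] integral_mono) (auto simp: spP)
      also have "\<dots> = b"
        using N1 by (simp add: b_def P1.prob_space)
      finally show ?thesis .
    qed
    have "(\<integral>x. G x \<partial>P0) - (\<integral>x. G x \<partial>P1) \<le> ((m + b) - (m - b)) * \<tau>"
      unfolding \<tau>_def using dev
      by (intro integral_diff_le_tv_dist assms) (auto simp: sP spP abs_diff_le_iff abs_le_iff dest!: dev)
    also have "\<dots> = 2 * \<tau> * b"
      by simp
    finally show "(\<integral>z. g z \<partial>(P0 \<bind> Q)) - (\<integral>z. g z \<partial>(P1 \<bind> Q))
        \<le> 2 * \<tau> * (\<epsilon> powr k / k + (\<integral>z. \<bar>g z\<bar> powr j \<partial>(P1 \<bind> Q)) / j)"
      using bind0(4)[OF g B] bind1(4)[OF g B] bind1(4)[of "\<lambda>z. \<bar>g z\<bar> powr j", OF _ Bj]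
      by (simp add: G_def N_def b_def)
  qed
  also have "(2 * \<tau> * \<epsilon>) powr k = (2 * \<epsilon>) powr k * tv_dist P0 P1 powr k"
    using \<tau> \<open>\<epsilon> \<ge> 0\<close> by (simp add: powr_mult \<tau>_def)
  finally show ?thesis .
qed

end
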